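(* Let $k\ge3$ and let $t=a^kb$ ($k$ copies of $a$ followed by one $b$, with $a\ne b$). Then every finite simple graph is $t$-representable.
   Context: Two words are isomorphic if one is obtained from the other by a bijective renaming of letters. For a word $w$ and letters $x,y$, $w|_{xy}$ denotes the subword of $w$ consisting of all occurrences of $x$ and $y$ (in order). A word $u$ over the two letters $\{a,b\}$ occurs in $w|_{xy}$ ($x\neq y$) if some contiguous factor of $w|_{xy}$ is isomorphic to $u$; otherwise $w|_{xy}$ avoids $u$. For a word $t$ on two letters, a graph $G=(V,E)$ is $t$-representable if there is a word $w$ over the alphabet $V$ containing each letter of $V$ at least once such that for all distinct $x,y\in V$, $xy\in E$ if and only if $w|_{xy}$ avoids $t$. *)

theory Defs
  imports Main "HOL-Library.Sublist" "HOL-Library.Ramsey"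
begin

text \<open>Words are lists. The two words may live over different alphabets (types).\<close>

definition word_iso :: "'a list \<Rightarrow> 'b list \<Rightarrow> bool" where
  "word_iso u v \<longleftrightarrow> (\<exists>f. bij_betw f (set u) (set v) \<and> v = map f u)"

definition restrict_word :: "'a list \<Rightarrow> 'a \<Rightarrow> 'a \<Rightarrow> 'a list" where
  "restrict_word w x y = filter (\<lambda>z. z = x \<or> z = y) w"

text \<open>The library predicate \<open>sublist\<close> means contiguous factor
  (scattered subwords are \<open>subseq\<close>).\<close>

definition occurs_in :: "'b list \<Rightarrow> 'a list \<Rightarrow> bool" where
  "occurs_in u v \<longleftrightarrow> (\<exists>z. sublist z v \<and> word_iso z u)"

abbreviation avoids :: "'a list \<Rightarrow> 'b list \<Rightarrow> bool" where
  "avoids v u \<equiv> \<not> occurs_in u v"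

text \<open>Edges are unordered pairs: \<open>nsets V 2\<close> is the set of two-element subsets of \<open>V\<close>.\<close>

definition finite_simple_graph :: "'a set \<Rightarrow> 'a set set \<Rightarrow> bool" where
  "finite_simple_graph V E \<longleftrightarrow> finite V \<and> E \<subseteq> nsets V 2"

definition representable :: "'b list \<Rightarrow> 'a set \<Rightarrow> 'a set set \<Rightarrow> bool" where
  "representable t V E \<longleftrightarrow>
     (\<exists>w. set w = V \<and>
        (\<forall>x\<in>V. \<forall>y\<in>V. x \<noteq> y \<longrightarrow> ({x, y} \<in> E \<longleftrightarrow> avoids (restrict_word w x y) t)))"

end

(* For every non-edge xy take the block y (x Z)^(k-1) x y Z, where Z lists the remaining vertices.
   Restricted to {x,y} it is y x^k y, which contains a^k b; restricted to any other pair it is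
   either a product of words pq with p \<noteq> q or y z^(k-1) y z. Since k \<ge> 3, concatenating words of the
   latter kinds never creates a run of length k. *)
theory Submission
  imports Defs
begin

text \<open>An isomorphism is injective on letters, so all letters sent to \<open>a\<close> coincide
  and the one sent to \<open>b\<close> differs from them. This trades renamings for concrete factors
  \<open>p^k q\<close>.\<close>

lemma occurs_in_power_then_letter:
  assumes "k > 0" "a \<noteq> b"
  shows "occurs_in (replicate k a @ [b]) v \<longleftrightarrow>
    (\<exists>p q. p \<noteq> q \<and> sublist (replicate k p @ [q]) v)"
proof
  assume "occurs_in (replicate k a @ [b]) v"
  then obtain z f where z: "sublist z v" and bij: "bij_betw f (set z) (set (replicate k a @ [b]))"
    and eq: "replicate k a @ [b] = map f z"
    unfolding occurs_in_def word_iso_def by metis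
  from eq obtain z' q where zq: "z = z' @ [q]" "map f z' = replicate k a" "f q = b"
    by (auto simp: append_eq_map_conv)
  have len: "length z' = k" using zq(2) by (metis length_map length_replicate)
  define p where "p = hd z'"
  have p: "p \<in> set z'" using len assms(1) by (auto simp: p_def)
  have fz: "f c = a" if "c \<in> set z'" for c
    using zq(2) that by (metis image_eqI in_set_replicate list.set_map)
  have "c = p" if "c \<in> set z'" for c
    using bij fz[OF that] fz[OF p] that p zq(1) by (auto simp: bij_betw_def inj_on_def)
  then have "z' = replicate k p" using len by (simp add: replicate_eqI)
  moreover have "p \<noteq> q" using fz[OF p] zq(3) assms(2) by auto
  ultimately show "\<exists>p q. p \<noteq> q \<and> sublist (replicate k p @ [q]) v" using z zq(1) by blast
next
  assume "\<exists>p q. p \<noteq> q \<and> sublist (replicate k p @ [q]) v"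
  then obtain p q where pq: "p \<noteq> q" "sublist (replicate k p @ [q]) v" by blast
  define f where "f = (\<lambda>c. if c = p then a else b)"
  have "bij_betw f (set (replicate k p @ [q])) (set (replicate k a @ [b]))"
    using assms pq(1) by (auto simp: bij_betw_def inj_on_def f_def)
  moreover have "replicate k a @ [b] = map f (replicate k p @ [q])"
    using pq(1) by (simp add: f_def)
  ultimately show "occurs_in (replicate k a @ [b]) v"
    using pq(2) unfolding occurs_in_def word_iso_def by blast
qed

text \<open>A bound on run lengths alone would not survive concatenation, so the invariant is a
  factorisation into the pieces that blocks leave on a pair of letters. The bound itself is derived
  in \<open>short_runs_no_power\<close>.\<close>

inductive short_runs :: "nat \<Rightarrow> 'a list \<Rightarrow> bool" for k where
  Nil: "short_runs k []"
| pair: "p \<noteq> q \<Longrightarrow> short_runs k v \<Longrightarrow> short_runs k (p # q # v)"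
| gap: "y \<noteq> z \<Longrightarrow> short_runs k v \<Longrightarrow> short_runs k (y # replicate (k - 1) z @ y # z # v)"

lemma short_runs_append: "short_runs k u \<Longrightarrow> short_runs k v \<Longrightarrow> short_runs k (u @ v)"
proof (induction rule: short_runs.induct)
  case (gap y z u)
  then show ?case using short_runs.gap[of y z k "u @ v"] by simp
qed (auto intro: short_runs.pair)

lemma short_runs_concat: "(\<And>u. u \<in> set us \<Longrightarrow> short_runs k u) \<Longrightarrow> short_runs k (concat us)"
  by (induction us) (auto intro: short_runs.Nil short_runs_append)

text \<open>Every piece starts with two different letters; for \<open>gap\<close> this needs
  \<open>k - 1 > 0\<close>. Hence a run entering a word from the left takes at most one of its
  letters.\<close>

lemma short_runs_hd_neq:
  assumes "k \<ge> 2" "short_runs k v"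
  shows "\<not> prefix (c # c # u) v"
  using assms(2)
proof cases
  case (gap y z v)
  then show ?thesis using assms(1) by (cases "k - 1") auto
qed auto

text \<open>Induction on the factorisation, excluding each possible starting point of a run in the
  first piece: the run is stopped by a different letter inside that piece, or it starts at the last
  letter and spills at most one letter into \<open>v\<close>, giving length at most 2.\<close>

lemma short_runs_no_power:
  assumes k: "k \<ge> 3" and "short_runs k v"
  shows "\<not> sublist (replicate k c) v"
  using assms(2)
proof induction
  case Nil
  show ?case using k by simp
next
  \<comment> \<open>Serves both constructors, because a \<open>gap\<close> piece also puts two
    different letters directly before \<open>v\<close>. A run starting at \<open>q\<close> would
    need \<open>k - 1 \<ge> 2\<close> equal letters at the front of \<open>v\<close>; this is where
    \<open>k \<ge> 3\<close> enters.\<close>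
  have step: "\<not> sublist (replicate k c) (p # q # v)"
    if pq: "p \<noteq> q" and v: "short_runs k v" "\<not> sublist (replicate k c) v" for p q v
  proof -
    obtain j where j: "k = Suc (Suc (Suc j))"
      using k by (metis Suc_le_D numeral_3_eq_3 Suc_le_mono)
    have "\<not> prefix (c # c # replicate j c) v"
      using short_runs_hd_neq[of k v] v(1) k by simp
    then show ?thesis using pq v(2) by (auto simp: j sublist_Cons_right)
  qed
  {
    case (pair p q v)
    then show ?case by (intro step)
  next
    case (gap y z v)
    have yz: "\<not> sublist (replicate k c) (y # z # v)" using gap by (intro step)
    \<comment> \<open>Positions \<open>0\<close> and \<open>m\<close> hold \<open>z\<close> and
      \<open>y\<close>, and both lie within the first \<open>k\<close> letters. The following
      induction then peels off the copies of \<open>z\<close> one by one, down to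
      \<open>yz\<close>.\<close>
    have nopre: "\<not> prefix (replicate k c) (replicate m z @ y # z # v)" if "0 < m" "m < k" for m
    proof
      assume "prefix (replicate k c) (replicate m z @ y # z # v)"
      then obtain r where r: "replicate m z @ y # z # v = replicate k c @ r" by (auto simp: prefix_def)
      have "z = c" using arg_cong[OF r, of "\<lambda>l. l ! 0"] that by (simp add: nth_append)
      moreover have "y = c" using arg_cong[OF r, of "\<lambda>l. l ! m"] that by (simp add: nth_append)
      ultimately show False using gap by simp
    qed
    have "\<not> sublist (replicate k c) (replicate m z @ y # z # v)" if "m < k" for m
      using that
    proof (induction m)
      case (Suc m)
      then show ?case using nopre[of "Suc m"] by (simp add: sublist_Cons_right)
    qed (use yz in simp)
    then have "\<not> sublist (replicate k c) (replicate (k - 1) z @ y # z # v)" using k by simp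
    moreover have "\<not> prefix (replicate k c) (y # replicate (k - 1) z @ y # z # v)"
    proof
      assume "prefix (replicate k c) (y # replicate (k - 1) z @ y # z # v)"
      then obtain r where r: "y # replicate (k - 1) z @ y # z # v = replicate k c @ r"
        by (auto simp: prefix_def)
      have "y = c" using arg_cong[OF r, of "\<lambda>l. l ! 0"] k by (simp add: nth_append)
      moreover have "z = c" using arg_cong[OF r, of "\<lambda>l. l ! 1"] k by (simp add: nth_append)
      ultimately show False using gap by simp
    qed
    ultimately show ?case by (simp add: sublist_Cons_right)
  }
qed

lemma filter_eq_distinct:
  assumes "distinct xs" "p \<in> set xs"
  shows "filter (\<lambda>z. z = p) xs = [p]"
  using assms by (induction xs) (auto simp: filter_empty_conv)

lemma restrict_word_distinct:
  assumes "distinct xs" "p \<in> set xs" "q \<in> set xs" "p \<noteq> q"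
  shows "restrict_word xs p q \<in> {[p, q], [q, p]}"
  using assms unfolding restrict_word_def
proof (induction xs)
  case (Cons a xs)
  have "filter (\<lambda>z. z = p \<or> z = q) xs = [q]" if "a = p"
    using Cons.prems that filter_eq_distinct[of xs q] filter_cong[of xs xs "\<lambda>z. z = p \<or> z = q" "\<lambda>z. z = q"]
    by auto
  moreover have "filter (\<lambda>z. z = p \<or> z = q) xs = [p]" if "a = q"
    using Cons.prems that filter_eq_distinct[of xs p] filter_cong[of xs xs "\<lambda>z. z = p \<or> z = q" "\<lambda>z. z = p"]
    by auto
  ultimately show ?case using Cons by auto
qed simp

lemma restrict_word_commute: "restrict_word w p q = restrict_word w q p"
  unfolding restrict_word_def by (rule filter_cong) auto

lemma restrict_word_append: "restrict_word (u @ v) p q = restrict_word u p q @ restrict_word v p q"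
  by (simp add: restrict_word_def)

lemma restrict_word_concat:
  "restrict_word (concat us) p q = concat (map (\<lambda>u. restrict_word u p q) us)"
  by (simp add: restrict_word_def filter_concat)

text \<open>The positions of \<open>y\<close> matter for a pair \<open>y\<close>, \<open>z\<close>
  with \<open>z\<close> in \<open>Z\<close>: the leading \<open>y\<close> separates the block from a
  \<open>z\<close> ending the preceding text, and the second \<open>y\<close> stands before the last
  \<open>Z\<close>, so that only \<open>k - 1\<close> copies of \<open>z\<close> lie between the
  two.\<close>

definition block :: "nat \<Rightarrow> 'a list \<Rightarrow> 'a \<times> 'a \<Rightarrow> 'a list" where
  "block k P = (\<lambda>(x, y). let Z = filter (\<lambda>z. z \<noteq> x \<and> z \<noteq> y) P in
     [y] @ concat (replicate (k - 1) (x # Z)) @ [x, y] @ Z)"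

lemma set_block: "x \<in> set P \<Longrightarrow> y \<in> set P \<Longrightarrow> set (block k P (x, y)) \<subseteq> set P"
  by (auto simp: block_def Let_def)

lemma concat_replicate_singleton: "concat (replicate n [x]) = replicate n x"
  by (induction n) auto

lemma restrict_block_self:
  assumes "k > 0" "x \<noteq> y"
  shows "restrict_word (block k P (x, y)) x y = [y] @ replicate k x @ [y]"
proof -
  have "restrict_word (filter (\<lambda>z. z \<noteq> x \<and> z \<noteq> y) P) x y = []"
    by (auto simp: restrict_word_def filter_empty_conv)
  then show ?thesis using assms
    \<comment> \<open>With \<open>k = Suc m\<close>, the \<open>m\<close> repeated copies of
      \<open>x\<close> and the one in \<open>[x, y]\<close> add up to \<open>k\<close>.\<close>
    by (cases k) (simp_all add: block_def Let_def restrict_word_def filter_concat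
        concat_replicate_singleton replicate_append_same)
qed

text \<open>At least one of \<open>p\<close>, \<open>q\<close> lies in \<open>Z\<close>. If both do,
  the same two-letter word is repeated \<open>k\<close> times; with \<open>x\<close> the result is
  \<open>(xz)^k\<close>; with \<open>y\<close> it is a single \<open>gap\<close> piece.\<close>

lemma short_runs_restrict_block:
  assumes P: "distinct P" "p \<in> set P" "q \<in> set P" "p \<noteq> q"
    and xy: "x \<noteq> y" "{p, q} \<noteq> {x, y}" and k: "k > 0"
  shows "short_runs k (restrict_word (block k P (x, y)) p q)"
proof -
  define Z where "Z = filter (\<lambda>z. z \<noteq> x \<and> z \<noteq> y) P"
  have Z: "distinct Z" "\<And>z. z \<in> set Z \<longleftrightarrow> z \<in> set P \<and> z \<noteq> x \<and> z \<noteq> y"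
    using P by (auto simp: Z_def)
  \<comment> \<open>Here \<open>p\<close> and \<open>q\<close> are rebound, so that the equation
    also applies to the pairs \<open>x\<close>, \<open>z\<close> and \<open>y\<close>,
    \<open>z\<close> below.\<close>
  have B: "restrict_word (block k P (x, y)) p q = restrict_word [y] p q
      @ concat (replicate (k - 1) (restrict_word (x # Z) p q)) @ restrict_word [x, y] p q
      @ restrict_word Z p q" for p q
    by (simp add: block_def Let_def restrict_word_def filter_concat flip: Z_def)
  have single: "restrict_word Z c z = [z]" if "z \<in> set Z" "c \<in> {x, y}" for c z
  proof -
    have "restrict_word Z c z = filter (\<lambda>a. a = z) Z"
      unfolding restrict_word_def using that Z(2) by (intro filter_cong) auto
    then show ?thesis using filter_eq_distinct Z(1) that(1) by metis
  qed
  have rep: "short_runs k (concat (replicate n [c, d]))" if "c \<noteq> d" for n and c d :: 'a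
    using that by (induction n) (auto intro: short_runs.intros)
  have x_z: "short_runs k (restrict_word (block k P (x, y)) x z)" if "z \<in> set Z" for z
  proof -
    have "z \<noteq> x" "z \<noteq> y" using that Z(2) by auto
    then have "restrict_word (block k P (x, y)) x z = concat (replicate (k - 1) [x, z]) @ [x, z]"
      unfolding B using single[OF that, of x] xy(1) by (simp add: restrict_word_def)
    then show ?thesis using rep[of x z] \<open>z \<noteq> x\<close> by (auto intro!: short_runs_append short_runs.intros)
  qed
  have y_z: "short_runs k (restrict_word (block k P (x, y)) y z)" if "z \<in> set Z" for z
  proof -
    have "z \<noteq> x" "z \<noteq> y" using that Z(2) by auto
    then have "restrict_word (block k P (x, y)) y z = y # replicate (k - 1) z @ y # z # []"
      unfolding B using single[OF that, of y] xy(1)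
      by (simp add: restrict_word_def concat_replicate_singleton)
    then show ?thesis using \<open>z \<noteq> y\<close> by (metis short_runs.intros(1,3))
  qed
  show ?thesis
  proof (cases "p \<in> set Z \<and> q \<in> set Z")
    case True
    then have "p \<notin> {x, y}" "q \<notin> {x, y}" using Z(2) by auto
    then have "restrict_word (block k P (x, y)) p q
        = concat (replicate (k - 1) (restrict_word Z p q)) @ restrict_word Z p q"
      unfolding B by (auto simp: restrict_word_def)
    moreover have "restrict_word Z p q \<in> {[p, q], [q, p]}"
      using restrict_word_distinct True Z(1) P(4) by metis
    ultimately show ?thesis using rep[of p q] rep[of q p] P(4)
      by (auto intro!: short_runs_append short_runs.intros)
  next
    case False
    then have "p \<in> {x, y} \<and> q \<in> set Z \<or> q \<in> {x, y} \<and> p \<in> set Z"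
      using Z(2) P xy by auto
    then show ?thesis using x_z y_z by (metis empty_iff insert_iff restrict_word_commute)
  qed
qed

theorem theorem9:
  fixes k :: nat and a b :: 'b and t :: "'b list"
    and V :: "'a set" and E :: "'a set set"
  assumes "k \<ge> 3"
    and "a \<noteq> b"
    and "t = replicate k a @ [b]"
    and "finite_simple_graph V E"
  shows "representable t V E"
proof -
  have k: "k > 0" using assms(1) by simp
  have "finite V" using assms(4) by (simp add: finite_simple_graph_def)
  then obtain P where P: "set P = V" "distinct P" using finite_distinct_list by blast
  \<comment> \<open>Both orientations of each non-edge are kept, so any \<open>x\<close>,
    \<open>y\<close> with \<open>{x, y} \<notin> E\<close> find the block \<open>(x, y)\<close>
    without a symmetry argument.\<close>
  define N where "N = {(x, y). x \<in> V \<and> y \<in> V \<and> x \<noteq> y \<and> {x, y} \<notin> E}"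
  have "N \<subseteq> V \<times> V" by (auto simp: N_def)
  then have "finite N" using \<open>finite V\<close> by (simp add: finite_subset)
  then obtain ns where ns: "set ns = N" using finite_list by blast
  \<comment> \<open>The initial \<open>P\<close> makes every vertex occur even if there are no
    non-edges; on each pair of distinct vertices it leaves just a two-letter \<open>pair\<close>
    piece.\<close>
  define w where "w = P @ concat (map (block k P) ns)"
  have occurs: "occurs_in t v \<longleftrightarrow> (\<exists>p q. p \<noteq> q \<and> sublist (replicate k p @ [q]) v)" for v :: "'a list"
    unfolding assms(3) by (rule occurs_in_power_then_letter[OF k assms(2)])
  have "set w = V"
    using set_block[of _ P _ k] P(1) ns by (fastforce simp: w_def N_def)
  moreover have "{x, y} \<in> E \<longleftrightarrow> avoids (restrict_word w x y) t"
    if xy: "x \<in> V" "y \<in> V" "x \<noteq> y" for x y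
  proof
    assume e: "{x, y} \<in> E"
    have "short_runs k (restrict_word P x y)"
      using restrict_word_distinct[of P x y] P xy by (auto intro!: short_runs.intros)
    moreover have "short_runs k (restrict_word (block k P n) x y)" if "n \<in> set ns" for n
    proof -
      obtain c d where cd: "n = (c, d)" by (cases n)
      then have "c \<noteq> d" "{x, y} \<noteq> {c, d}" using that e ns by (auto simp: N_def)
      then show ?thesis unfolding cd using short_runs_restrict_block P xy k by metis
    qed
    ultimately have "short_runs k (restrict_word w x y)"
      unfolding w_def restrict_word_append restrict_word_concat
      by (auto intro!: short_runs_append short_runs_concat)
    then have no: "\<not> sublist (replicate k c) (restrict_word w x y)" for c
      by (rule short_runs_no_power[OF assms(1)])
    \<comment> \<open>A factor \<open>p^k q\<close> would contain the run \<open>p^k\<close>, which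
      \<open>no\<close> excludes.\<close>
    show "avoids (restrict_word w x y) t"
      unfolding occurs using no sublist_order.order_trans[OF sublist_append_rightI] by blast
  next
    assume av: "avoids (restrict_word w x y) t"
    show "{x, y} \<in> E"
    proof (rule ccontr)
      assume "{x, y} \<notin> E"
      then have "(x, y) \<in> set ns" using xy ns by (simp add: N_def)
      then obtain us vs where "ns = us @ (x, y) # vs" by (meson split_list)
      then have "w = (P @ concat (map (block k P) us)) @ block k P (x, y) @ concat (map (block k P) vs)"
        by (simp add: w_def)
      then obtain u v where "w = u @ block k P (x, y) @ v" by blast
      \<comment> \<open>The bracketing moves the leading \<open>y\<close> of the block into the left
        context and isolates \<open>x^k y\<close> as the factor.\<close>
      then have "restrict_word w x y
          = (restrict_word u x y @ [y]) @ (replicate k x @ [y]) @ restrict_word v x y"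
        using restrict_block_self[OF k xy(3), of P] by (simp add: restrict_word_append)
      then have "sublist (replicate k x @ [y]) (restrict_word w x y)"
        by (metis sublist_appendI)
      then show False using av xy(3) unfolding occurs by blast
    qed
  qed
  ultimately show ?thesis unfolding representable_def by blast
qed

end
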